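(* Let $n$ be a positive integer and let $Q_a=(Q,\cdot)$, $Q=\{1,\ldots,n\}$, be a naturally ordered idempotent translatable quasigroup of order $n$ with multiplication $x\cdot y=[ax+by]_n$, $a,b\in\mathbb{Z}_n$ (so $[a+b]_n=1$ and $(a,n)=(b,n)=1$). Let $a',b'\in\mathbb{Z}_n$ be the elements with $[aa']_n=[bb']_n=1$. Then $Q_a$ is $k$-translatable for $k=[1-b']_n$, and its parastrophes are $k^*$-translatable, where (1) $k^*=a$ for $(Q,\circ_1)$; (2) $k^*=[1-k]_n$ for $(Q,\circ_2)$; (3) $k^*=[1-a]_n$ for $(Q,\circ_3)$; (4) $k^*=a'$ for $(Q,\circ_4)$; (5) $k^*=[1-a']_n$ for $(Q,\circ_5)$.
   Context: For an integer $m$, $[m]_n$ is the element of $\{1,\ldots,n\}$ congruent to $m$ modulo $n$, with $0=n$; an equation $[u]_n=v$ with $v$ an integer means $u\equiv v\pmod n$. A quasigroup is a set with a binary operation such that $ax=b$ and $xa=b$ are uniquely solvable for $x$; it is idempotent if $x\cdot x=x$. A groupoid $(Q,* )$ on $Q=\{1,\ldots,n\}$ (naturally ordered) is $k$-translatable if $i*j=[i+1]_n*[j+k]_n$ for all $i,j\in Q$, and translatable if it is $k$-translatable for some $k$. The parastrophes $(Q,\circ_i)$, $i=1,\ldots,5$, of a quasigroup $(Q,\cdot)$ are defined by: $x\circ_1y=z\Leftrightarrow x\cdot z=y$; $x\circ_2y=z\Leftrightarrow z\cdot y=x$; $x\circ_3y=z\Leftrightarrow z\cdot x=y$; $x\circ_4y=z\Leftrightarrow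 y\cdot z=x$; $x\circ_5y=z\Leftrightarrow y\cdot x=z$. *)

theory Defs
  imports "HOL-Number_Theory.Cong"
begin

definition rep :: "int \<Rightarrow> int \<Rightarrow> int" where
  "rep n m = (if m mod n = 0 then n else m mod n)"

lemma rep_mem: "n > 0 \<Longrightarrow> rep n m \<in> {1..n}"
  using pos_mod_sign[of n m] pos_mod_bound[of n m]
  by (auto simp: rep_def simp del: pos_mod_sign pos_mod_bound)

lemma rep_cong: "[rep n m = m] (mod n)"
  by (simp add: rep_def cong_def)

definition groupoid_on :: "'a set \<Rightarrow> ('a \<Rightarrow> 'a \<Rightarrow> 'a) \<Rightarrow> bool" where
  "groupoid_on Q f \<longleftrightarrow> (\<forall>x\<in>Q. \<forall>y\<in>Q. f x y \<in> Q)"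

definition quasigroup_on :: "'a set \<Rightarrow> ('a \<Rightarrow> 'a \<Rightarrow> 'a) \<Rightarrow> bool" where
  "quasigroup_on Q f \<longleftrightarrow> groupoid_on Q f \<and>
     (\<forall>a\<in>Q. \<forall>b\<in>Q. (\<exists>!x. x \<in> Q \<and> f a x = b) \<and> (\<exists>!x. x \<in> Q \<and> f x a = b))"

definition idempotent_on :: "'a set \<Rightarrow> ('a \<Rightarrow> 'a \<Rightarrow> 'a) \<Rightarrow> bool" where
  "idempotent_on Q f \<longleftrightarrow> (\<forall>x\<in>Q. f x x = x)"

text \<open>The natural order of the carrier is built in: the carrier is the set of integers
  from 1 to \<open>n\<close>. The shift \<open>k\<close> matters only modulo \<open>n\<close>.\<close>

definition k_translatable :: "int \<Rightarrow> (int \<Rightarrow> int \<Rightarrow> int) \<Rightarrow> int \<Rightarrow> bool" where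
  "k_translatable n f k \<longleftrightarrow> groupoid_on {1..n} f \<and>
     (\<forall>i\<in>{1..n}. \<forall>j\<in>{1..n}. f i j = f (rep n (i + 1)) (rep n (j + k)))"

definition translatable :: "int \<Rightarrow> (int \<Rightarrow> int \<Rightarrow> int) \<Rightarrow> bool" where
  "translatable n f \<longleftrightarrow> (\<exists>k. k_translatable n f k)"

text \<open>On a quasigroup the descriptions below determine \<open>z\<close> uniquely;
  see the lemma \<open>parastrophe_iff\<close>.\<close>

definition parastrophe1 :: "'a set \<Rightarrow> ('a \<Rightarrow> 'a \<Rightarrow> 'a) \<Rightarrow> 'a \<Rightarrow> 'a \<Rightarrow> 'a" where
  "parastrophe1 Q f x y = (THE z. z \<in> Q \<and> f x z = y)"

definition parastrophe2 :: "'a set \<Rightarrow> ('a \<Rightarrow> 'a \<Rightarrow> 'a) \<Rightarrow> 'a \<Rightarrow> 'a \<Rightarrow> 'a" where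
  "parastrophe2 Q f x y = (THE z. z \<in> Q \<and> f z y = x)"

definition parastrophe3 :: "'a set \<Rightarrow> ('a \<Rightarrow> 'a \<Rightarrow> 'a) \<Rightarrow> 'a \<Rightarrow> 'a \<Rightarrow> 'a" where
  "parastrophe3 Q f x y = (THE z. z \<in> Q \<and> f z x = y)"

definition parastrophe4 :: "'a set \<Rightarrow> ('a \<Rightarrow> 'a \<Rightarrow> 'a) \<Rightarrow> 'a \<Rightarrow> 'a \<Rightarrow> 'a" where
  "parastrophe4 Q f x y = (THE z. z \<in> Q \<and> f y z = x)"

definition parastrophe5 :: "'a set \<Rightarrow> ('a \<Rightarrow> 'a \<Rightarrow> 'a) \<Rightarrow> 'a \<Rightarrow> 'a \<Rightarrow> 'a" where
  "parastrophe5 Q f x y = (THE z. z \<in> Q \<and> f y x = z)"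

lemma The_eq_iff: "\<exists>!z. P z \<Longrightarrow> (THE z. P z) = z \<longleftrightarrow> P z"
  by (metis theI')

lemma parastrophe_iff:
  assumes "quasigroup_on Q f" "x \<in> Q" "y \<in> Q" "z \<in> Q"
  shows "parastrophe1 Q f x y = z \<longleftrightarrow> f x z = y"
    and "parastrophe2 Q f x y = z \<longleftrightarrow> f z y = x"
    and "parastrophe3 Q f x y = z \<longleftrightarrow> f z x = y"
    and "parastrophe4 Q f x y = z \<longleftrightarrow> f y z = x"
    and "parastrophe5 Q f x y = z \<longleftrightarrow> f y x = z"
proof -
  have l: "\<exists>!z. z \<in> Q \<and> f a z = b" and r: "\<exists>!z. z \<in> Q \<and> f z a = b"
    and c: "\<exists>!z. z \<in> Q \<and> f a b = z" if "a \<in> Q" "b \<in> Q" for a b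
    using assms(1) that by (auto simp: quasigroup_on_def groupoid_on_def)
  show "parastrophe1 Q f x y = z \<longleftrightarrow> f x z = y"
    unfolding parastrophe1_def using The_eq_iff[OF l] assms by simp
  show "parastrophe2 Q f x y = z \<longleftrightarrow> f z y = x"
    unfolding parastrophe2_def using The_eq_iff[OF r] assms by simp
  show "parastrophe3 Q f x y = z \<longleftrightarrow> f z x = y"
    unfolding parastrophe3_def using The_eq_iff[OF r] assms by simp
  show "parastrophe4 Q f x y = z \<longleftrightarrow> f y z = x"
    unfolding parastrophe4_def using The_eq_iff[OF l] assms by simp
  show "parastrophe5 Q f x y = z \<longleftrightarrow> f y x = z"
    unfolding parastrophe5_def using The_eq_iff[OF c] assms by simp
qed

end

theory Submission
  imports Defs
begin

text \<open>
  Every operation involved is linear up to a unit: its value \<open>z\<close> at \<open>(x, y)\<close> satisfies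
  \<open>p z = c x + d y\<close> modulo \<open>n\<close> for some unit \<open>p\<close>. Replacing \<open>(x, y)\<close> by
  \<open>(x + 1, y + k)\<close> changes the right-hand side by \<open>c + d k\<close>, so the operation is
  \<open>k\<close>-translatable as soon as \<open>c + d k = 0\<close> modulo \<open>n\<close>. Reading off \<open>p\<close>, \<open>c\<close>, \<open>d\<close> from
  \<open>a x + b y = z\<close> for each parastrophe leaves congruences in \<open>a\<close>, \<open>b\<close>, \<open>a'\<close>, \<open>b'\<close>.
\<close>

text \<open>Two elements of \<open>{1..n}\<close> differ by less than \<open>n\<close>, and 0 is the
  only multiple of \<open>n\<close> that small.\<close>

lemma cong_imp_eq_range:
  fixes n x y :: int
  assumes "x \<in> {1..n}" "y \<in> {1..n}" "[x = y] (mod n)"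
  shows "x = y"
proof -
  have "n dvd x - y"
    using assms(3) by (simp add: cong_iff_dvd_diff)
  moreover have "\<bar>x - y\<bar> < n"
    using assms(1,2) by auto
  ultimately have "x - y = 0"
    using dvd_imp_le_int[of "x - y" n] by linarith
  then show ?thesis by simp
qed

text \<open>Keeping the unit \<open>p\<close> next to the value avoids inverses: the defining
  equation of a parastrophe fits after moving one term across. The wrap-around of \<open>rep\<close>
  vanishes modulo \<open>n\<close>, and \<open>p\<close> is cancelled at the end.\<close>

lemma k_translatableI_linear:
  fixes n c d p k :: int
  assumes n: "n > 0" and p: "coprime p n"
    and g: "\<And>x y. x \<in> {1..n} \<Longrightarrow> y \<in> {1..n} \<Longrightarrow>
              g x y \<in> {1..n} \<and> [p * g x y = c * x + d * y] (mod n)"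
    and k: "[c + d * k = 0] (mod n)"
  shows "k_translatable n g k"
  unfolding k_translatable_def groupoid_on_def
proof (intro conjI ballI)
  fix i j assume ij: "i \<in> {1..n}" "j \<in> {1..n}"
  show "g i j \<in> {1..n}" using g ij by blast
  let ?i = "rep n (i + 1)" and ?j = "rep n (j + k)"
  have ij': "?i \<in> {1..n}" "?j \<in> {1..n}"
    using n by (auto intro!: rep_mem simp del: atLeastAtMost_iff)
  have "[p * g ?i ?j = c * ?i + d * ?j] (mod n)"
    using g ij' by blast
  also have "[c * ?i + d * ?j = c * (i + 1) + d * (j + k)] (mod n)"
    by (intro cong_add cong_mult cong_refl rep_cong)
  also have "c * (i + 1) + d * (j + k) = (c * i + d * j) + (c + d * k)"
    by (simp add: algebra_simps)
  also have "[\<dots> = (c * i + d * j) + 0] (mod n)"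
    by (intro cong_add cong_refl k)
  also have "[c * i + d * j + 0 = p * g i j] (mod n)"
    using g ij by (metis add.right_neutral cong_sym)
  finally have "[g ?i ?j = g i j] (mod n)"
    using p by (simp add: cong_mult_lcancel)
  then have "g ?i ?j = g i j"
    using g ij ij' by (intro cong_imp_eq_range) blast+
  then show "g i j = g ?i ?j" by simp
qed

text \<open>Solvability (closure for the fifth) yields some \<open>z\<close> in \<open>Q\<close>
  with the defining equation, and \<open>parastrophe_iff\<close> identifies this \<open>z\<close>
  with the value of the definite description.\<close>

lemma parastrophe_mem:
  assumes "quasigroup_on Q f" "x \<in> Q" "y \<in> Q"
  shows "parastrophe1 Q f x y \<in> Q" "parastrophe2 Q f x y \<in> Q" "parastrophe3 Q f x y \<in> Q"
    "parastrophe4 Q f x y \<in> Q" "parastrophe5 Q f x y \<in> Q"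
proof -
  have ex: "\<exists>z\<in>Q. f u z = v" "\<exists>z\<in>Q. f z u = v" "f u v \<in> Q" if "u \<in> Q" "v \<in> Q" for u v
    using assms(1) that unfolding quasigroup_on_def groupoid_on_def by blast+
  show "parastrophe1 Q f x y \<in> Q"
    using ex(1)[of x y] parastrophe_iff(1)[OF assms] assms(2,3) by metis
  show "parastrophe2 Q f x y \<in> Q"
    using ex(2)[of y x] parastrophe_iff(2)[OF assms] assms(2,3) by metis
  show "parastrophe3 Q f x y \<in> Q"
    using ex(2)[of x y] parastrophe_iff(3)[OF assms] assms(2,3) by metis
  show "parastrophe4 Q f x y \<in> Q"
    using ex(1)[of y x] parastrophe_iff(4)[OF assms] assms(2,3) by metis
  show "parastrophe5 Q f x y \<in> Q"
    using ex(3)[of y x] parastrophe_iff(5)[OF assms] assms(2,3) by metis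
qed

text \<open>Membership allows \<open>z\<close> in \<open>parastrophe_iff\<close> to be the value of
  the parastrophe itself.\<close>

lemma parastrophe_eq:
  assumes "quasigroup_on Q f" "x \<in> Q" "y \<in> Q"
  shows "f x (parastrophe1 Q f x y) = y" "f (parastrophe2 Q f x y) y = x"
    "f (parastrophe3 Q f x y) x = y" "f y (parastrophe4 Q f x y) = x"
    "f y x = parastrophe5 Q f x y"
  using parastrophe_iff[OF assms] parastrophe_mem[OF assms] by blast+

text \<open>The carrier element \<open>n\<close> is 0 modulo \<open>n\<close>, so a solution of
  \<open>f x n = 1\<close> is an inverse of \<open>a\<close>, and a solution of
  \<open>f n y = 1\<close> is an inverse of \<open>b\<close>.\<close>

lemma linear_quasigroup_coprime:
  fixes n a b :: int
  assumes n: "n > 0"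
    and f: "\<And>x y. x \<in> {1..n} \<Longrightarrow> y \<in> {1..n} \<Longrightarrow> [a * x + b * y = f x y] (mod n)"
    and quasi: "quasigroup_on {1..n} f"
  shows "coprime a n" "coprime b n"
proof -
  have mem: "n \<in> {1..n}" "1 \<in> {1..n}" using n by auto
  then obtain x y where x: "x \<in> {1..n}" "f x n = 1" and y: "y \<in> {1..n}" "f n y = 1"
    using quasi unfolding quasigroup_on_def by metis
  have "[a * x = 1] (mod n)"
    using f[OF x(1) mem(1)] x(2) by (simp add: cong_def)
  then show "coprime a n" using coprime_iff_invertible_int by blast
  have "[b * y = 1] (mod n)"
    using f[OF mem(1) y(1)] y(2) by (simp add: cong_def)
  then show "coprime b n" using coprime_iff_invertible_int by blast
qed

theorem theorem5p3:
  fixes n a b :: int and f :: "int \<Rightarrow> int \<Rightarrow> int"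
  assumes "n > 0"
    and "a \<in> {1..n}" and "b \<in> {1..n}"
    and "\<forall>x\<in>{1..n}. \<forall>y\<in>{1..n}. f x y = rep n (a * x + b * y)"
    and "quasigroup_on {1..n} f"
    and "idempotent_on {1..n} f"
    and "translatable n f"
  shows "[a + b = 1] (mod n) \<and> coprime a n \<and> coprime b n \<and>
    (\<forall>a'\<in>{1..n}. \<forall>b'\<in>{1..n}. \<forall>k.
      [a * a' = 1] (mod n) \<longrightarrow> [b * b' = 1] (mod n) \<longrightarrow> k = rep n (1 - b') \<longrightarrow>
        k_translatable n f k \<and>
        k_translatable n (parastrophe1 {1..n} f) a \<and>
        k_translatable n (parastrophe2 {1..n} f) (rep n (1 - k)) \<and>
        k_translatable n (parastrophe3 {1..n} f) (rep n (1 - a)) \<and>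
        k_translatable n (parastrophe4 {1..n} f) a' \<and>
        k_translatable n (parastrophe5 {1..n} f) (rep n (1 - a')))"
proof -
  let ?Q = "{1..n}"
  note quasi = assms(5)
  have f: "[a * x + b * y = f x y] (mod n)" if "x \<in> ?Q" "y \<in> ?Q" for x y
    using assms(4) that by (metis cong_sym rep_cong)
  have "1 \<in> ?Q" using assms(1) by simp
  \<comment> \<open>Idempotency at 1 reads \<open>f 1 1 = 1\<close>.\<close>
  then have sum: "[a + b = 1] (mod n)"
    using f[of 1 1] assms(6) by (simp add: idempotent_on_def)
  have cop: "coprime a n" "coprime b n"
    using linear_quasigroup_coprime[OF assms(1) f quasi] by blast+
  have "k_translatable n f k \<and>
        k_translatable n (parastrophe1 ?Q f) a \<and>
        k_translatable n (parastrophe2 ?Q f) (rep n (1 - k)) \<and>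
        k_translatable n (parastrophe3 ?Q f) (rep n (1 - a)) \<and>
        k_translatable n (parastrophe4 ?Q f) a' \<and>
        k_translatable n (parastrophe5 ?Q f) (rep n (1 - a'))"
    if a': "[a * a' = 1] (mod n)" and b': "[b * b' = 1] (mod n)" and k: "k = rep n (1 - b')"
    for a' b' k
  proof (intro conjI)
    \<comment> \<open>Each congruence becomes an integer equation with an explicit multiplier, so
      that every shift condition below reduces to a polynomial identity for
      \<open>algebra\<close>.\<close>
    obtain s where s: "a + b = 1 + n * s"
      using cong_sym[OF sum] by (metis cong_iff_lin mult.commute)
    obtain t where t: "a * a' = 1 + n * t"
      using cong_sym[OF a'] by (metis cong_iff_lin mult.commute)
    obtain u where u: "b * b' = 1 + n * u"
      using cong_sym[OF b'] by (metis cong_iff_lin mult.commute)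
    obtain v where v: "k = 1 - b' + n * v"
      unfolding k using cong_sym[OF rep_cong] by (metis cong_iff_lin mult.commute)
    have rep_ex: "\<exists>w. rep n m = m + n * w" for m
      using cong_sym[OF rep_cong] by (metis cong_iff_lin mult.commute)
    note mem = parastrophe_mem[OF quasi] and eq = parastrophe_eq[OF quasi]
    have zero: "[m = 0] (mod n)" if "m = n * q" for m q :: int
      using that by (simp add: cong_0_iff)
    have mem_f: "f x y \<in> ?Q" if "x \<in> ?Q" "y \<in> ?Q" for x y
      using quasi that by (simp add: quasigroup_on_def groupoid_on_def)

    show "k_translatable n f k"
    proof (rule k_translatableI_linear[OF assms(1) coprime_1_left])
      show "f x y \<in> ?Q \<and> [1 * f x y = a * x + b * y] (mod n)"
        if "x \<in> ?Q" "y \<in> ?Q" for x y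
        using f[OF that] mem_f[OF that] by (metis cong_sym mult_1)
      \<comment> \<open>Modulo \<open>n\<close>, \<open>b * k = b - b * b' = b - 1\<close>, and
        \<open>a + b = 1\<close>; the witness collects the multiples of \<open>n\<close>.\<close>
      show "[a + b * k = 0] (mod n)"
        by (rule zero[of _ "s - u + b * v"]) (use s u v in algebra)
    qed
    show "k_translatable n (parastrophe1 ?Q f) a"
    proof (rule k_translatableI_linear[OF assms(1) cop(2)])
      fix x y assume xy: "x \<in> ?Q" "y \<in> ?Q"
      show "parastrophe1 ?Q f x y \<in> ?Q \<and>
          [b * parastrophe1 ?Q f x y = - a * x + 1 * y] (mod n)"
        using f[OF xy(1) mem(1)[OF xy]] mem(1)[OF xy] eq(1)[OF xy]
        by (simp add: cong_iff_dvd_diff algebra_simps del: atLeastAtMost_iff)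
    \<comment> \<open>With coefficients \<open>- a\<close> and 1, the shift \<open>a\<close> makes
      the remaining condition exactly \<open>- a + 1 * a = 0\<close>.\<close>
    qed simp
    show "k_translatable n (parastrophe2 ?Q f) (rep n (1 - k))"
    proof (rule k_translatableI_linear[OF assms(1) cop(1)])
      fix x y assume xy: "x \<in> ?Q" "y \<in> ?Q"
      show "parastrophe2 ?Q f x y \<in> ?Q \<and>
          [a * parastrophe2 ?Q f x y = 1 * x + - b * y] (mod n)"
        using f[OF mem(2)[OF xy] xy(2)] mem(2)[OF xy] eq(2)[OF xy]
        by (simp add: cong_iff_dvd_diff algebra_simps del: atLeastAtMost_iff)
    next
      \<comment> \<open>The shift is congruent to \<open>b'\<close>, so the condition is
        \<open>b * b' = 1\<close> in disguise.\<close>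
      obtain w where "rep n (1 - k) = 1 - k + n * w" using rep_ex by blast
      then show "[1 + - b * rep n (1 - k) = 0] (mod n)"
        by (intro zero[of _ "- u + b * v - b * w"]) (use u v in algebra)
    qed
    show "k_translatable n (parastrophe3 ?Q f) (rep n (1 - a))"
    proof (rule k_translatableI_linear[OF assms(1) cop(1)])
      fix x y assume xy: "x \<in> ?Q" "y \<in> ?Q"
      show "parastrophe3 ?Q f x y \<in> ?Q \<and>
          [a * parastrophe3 ?Q f x y = - b * x + 1 * y] (mod n)"
        using f[OF mem(3)[OF xy] xy(1)] mem(3)[OF xy] eq(3)[OF xy]
        by (simp add: cong_iff_dvd_diff algebra_simps del: atLeastAtMost_iff)
    next
      \<comment> \<open>Here the shift is congruent to \<open>b\<close>, because
        \<open>a + b = 1\<close> modulo \<open>n\<close>.\<close>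
      obtain w where "rep n (1 - a) = 1 - a + n * w" using rep_ex by blast
      then show "[- b + 1 * rep n (1 - a) = 0] (mod n)"
        by (intro zero[of _ "w - s"]) (use s in algebra)
    qed
    show "k_translatable n (parastrophe4 ?Q f) a'"
    proof (rule k_translatableI_linear[OF assms(1) cop(2)])
      fix x y assume xy: "x \<in> ?Q" "y \<in> ?Q"
      show "parastrophe4 ?Q f x y \<in> ?Q \<and>
          [b * parastrophe4 ?Q f x y = 1 * x + - a * y] (mod n)"
        using f[OF xy(2) mem(4)[OF xy]] mem(4)[OF xy] eq(4)[OF xy]
        by (simp add: cong_iff_dvd_diff algebra_simps del: atLeastAtMost_iff)
    next
      show "[1 + - a * a' = 0] (mod n)"
        by (rule zero[of _ "- t"]) (use t in algebra)
    qed
    show "k_translatable n (parastrophe5 ?Q f) (rep n (1 - a'))"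
    proof (rule k_translatableI_linear[OF assms(1) coprime_1_left])
      fix x y assume xy: "x \<in> ?Q" "y \<in> ?Q"
      show "parastrophe5 ?Q f x y \<in> ?Q \<and>
          [1 * parastrophe5 ?Q f x y = b * x + a * y] (mod n)"
        using f[OF xy(2,1)] mem(5)[OF xy] eq(5)[OF xy]
        by (metis add.commute mult_1 cong_sym)
    next
      \<comment> \<open>Modulo \<open>n\<close>, \<open>b + a * (1 - a')\<close> is
        \<open>(a + b) - a * a' = 1 - 1\<close>.\<close>
      obtain w where "rep n (1 - a') = 1 - a' + n * w" using rep_ex by blast
      then show "[b + a * rep n (1 - a') = 0] (mod n)"
        by (intro zero[of _ "s - t + a * w"]) (use s t in algebra)
    qed
  qed
  then show ?thesis using sum cop by blast
qed

end
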